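(* Let $m,n$ be positive integers and let $s$ be an integer relatively prime to $n$ such that $s$ has order $m$ modulo $n$ and $s$ has order $m$ modulo $q$ for every prime divisor $q$ of $n$. Let $G_{m,n}^\star=\langle x, y\mid x^m=y^n=1,\ x^{-1}yx=y^s\rangle$. Then $\mathsf d(G_{m,n}^\star)=m+n-2$.
   Context: For an integer $s$ relatively prime to a positive integer $n$, the order of $s$ modulo $n$ is the least positive integer $k$ with $s^k\equiv 1\pmod n$. A sequence over a finite group $G$ (written multiplicatively, identity $1$) is a finite unordered sequence of elements of $G$ with repetition allowed (i.e. a finite multiset); its length is the number of its terms counted with multiplicity. A subsequence of $S$ is a sub-multiset. A sequence $g_1,\ldots,g_\ell$ is called product-one if its terms can be ordered so that their product is $1$, i.e. $g_{\tau(1)}g_{\tau(2)}\cdots g_{\tau(\ell)}=1$ for some permutation $\tau$ of $\{1,\ldots,\ell\}$. The small Davenport constant $\mathsf d(G)$ is the maximal integer $\ell$ such that there is a sequence over $G$ of length $\ell$ which has no nonempty product-one subsequence. *)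

theory Defs
  imports
    "HOL-Algebra.Algebra"
    "HOL-Number_Theory.Number_Theory"
    "HOL-Library.Multiset"
begin

section \<open>Groups given by generators and relations\<close>

text \<open>A word over the generators \<open>'a\<close>: the letter \<open>(a, True)\<close> stands for the generator \<open>a\<close> and
  \<open>(a, False)\<close> for its formal inverse. A relation \<open>u = v\<close> is the pair \<open>(u, v)\<close>.\<close>

type_synonym 'a word = "('a \<times> bool) list"

definition gen_pow :: "'a \<Rightarrow> int \<Rightarrow> 'a word" where
  "gen_pow a k = replicate (nat \<bar>k\<bar>) (a, k \<ge> 0)"

text \<open>The least congruence on the free monoid of words that contains the cancellations
  \<open>a a\<inverse> = a\<inverse> a = 1\<close> and the relations in \<open>R\<close>.\<close>

inductive word_cong :: "('a word \<times> 'a word) set \<Rightarrow> 'a word \<Rightarrow> 'a word \<Rightarrow> bool"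
  for R :: "('a word \<times> 'a word) set" where
  refl: "word_cong R u u"
| sym: "word_cong R u v \<Longrightarrow> word_cong R v u"
| trans: "word_cong R u v \<Longrightarrow> word_cong R v w \<Longrightarrow> word_cong R u w"
| append: "word_cong R u u' \<Longrightarrow> word_cong R v v' \<Longrightarrow> word_cong R (u @ v) (u' @ v')"
| cancel: "word_cong R [(a, e), (a, \<not> e)] []"
| rel: "(u, v) \<in> R \<Longrightarrow> word_cong R u v"

definition word_class :: "('a word \<times> 'a word) set \<Rightarrow> 'a word \<Rightarrow> 'a word set" where
  "word_class R u = {v. word_cong R u v}"

definition presented_group :: "('a word \<times> 'a word) set \<Rightarrow> 'a word set monoid" where
  "presented_group R =
    \<lparr>carrier = range (word_class R),
     monoid.mult = (\<lambda>A B. \<Union>u\<in>A. \<Union>v\<in>B. word_class R (u @ v)),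
     one = word_class R []\<rparr>"

lemma presented_group_carrier: "carrier (presented_group R) = range (word_class R)"
  by (simp add: presented_group_def)

lemma word_class_eq_iff: "word_class R u = word_class R v \<longleftrightarrow> word_cong R u v"
proof
  assume "word_class R u = word_class R v"
  moreover have "v \<in> word_class R v"
    by (simp add: word_class_def word_cong.refl)
  ultimately show "word_cong R u v"
    by (auto simp: word_class_def)
next
  assume "word_cong R u v"
  then have "word_cong R u w \<longleftrightarrow> word_cong R v w" for w
    by (metis word_cong.sym word_cong.trans)
  then show "word_class R u = word_class R v"
    by (simp add: word_class_def)
qed

lemma presented_group_mult:
  "word_class R u \<otimes>\<^bsub>presented_group R\<^esub> word_class R v = word_class R (u @ v)"
proof -
  have "word_class R (u' @ v') = word_class R (u @ v)"
    if "u' \<in> word_class R u" "v' \<in> word_class R v" for u' v'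
    using that unfolding word_class_eq_iff
    by (metis mem_Collect_eq word_class_def word_cong.append word_cong.sym)
  moreover have "u \<in> word_class R u" "v \<in> word_class R v"
    by (simp_all add: word_class_def word_cong.refl)
  ultimately have "(\<Union>u'\<in>word_class R u. \<Union>v'\<in>word_class R v. word_class R (u' @ v')) =
      word_class R (u @ v)"
    by blast
  then show ?thesis
    by (simp add: presented_group_def)
qed

lemma word_cong_inverse: "word_cong R (map (\<lambda>(a, e). (a, \<not> e)) (rev u) @ u) []"
proof (induction u)
  case Nil
  show ?case by (simp add: word_cong.refl)
next
  case (Cons p u)
  obtain a e where p: "p = (a, e)" by (cases p)
  let ?i = "map (\<lambda>(a, e). (a, \<not> e)) (rev u)"
  have "word_cong R [(a, \<not> e), (a, e)] []"
    using word_cong.cancel[of R a "\<not> e"] by simp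
  then have "word_cong R (?i @ [(a, \<not> e), (a, e)] @ u) (?i @ [] @ u)"
    by (intro word_cong.append word_cong.refl)
  then have "word_cong R (?i @ [(a, \<not> e), (a, e)] @ u) []"
    using Cons.IH unfolding append_Nil by (rule word_cong.trans)
  then show ?case by (simp add: p)
qed

lemma group_presented_group: "group (presented_group R)"
proof (rule groupI)
  note car = presented_group_carrier[of R]
  have one: "\<one>\<^bsub>presented_group R\<^esub> = word_class R []"
    by (simp add: presented_group_def)
  show "\<one>\<^bsub>presented_group R\<^esub> \<in> carrier (presented_group R)"
    by (simp add: car one)
  fix A assume "A \<in> carrier (presented_group R)"
  then obtain u where A: "A = word_class R u" by (auto simp: car)
  show "\<one>\<^bsub>presented_group R\<^esub> \<otimes>\<^bsub>presented_group R\<^esub> A = A"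
    by (simp add: one A presented_group_mult)
  show "\<exists>B\<in>carrier (presented_group R). B \<otimes>\<^bsub>presented_group R\<^esub> A = \<one>\<^bsub>presented_group R\<^esub>"
    using word_cong_inverse[of R u]
    by (auto simp: one A car presented_group_mult word_class_eq_iff)
qed (auto simp: presented_group_mult presented_group_carrier)

section \<open>The groups under consideration\<close>

datatype gen = gen_x | gen_y

text \<open>\<open>\<langle>x, y | x\<^sup>m = y\<^sup>n = 1, x\<inverse> y x = y\<^sup>s\<rangle>\<close>\<close>

definition G_star :: "nat \<Rightarrow> nat \<Rightarrow> int \<Rightarrow> gen word set monoid" where
  "G_star m n s = presented_group
    {(gen_pow gen_x (int m), []),
     (gen_pow gen_y (int n), []),
     (gen_pow gen_x (- 1) @ gen_pow gen_y 1 @ gen_pow gen_x 1, gen_pow gen_y s)}"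

section \<open>The small Davenport constant\<close>

definition product_one :: "('a, 'b) monoid_scheme \<Rightarrow> 'a multiset \<Rightarrow> bool" where
  "product_one G S \<longleftrightarrow> (\<exists>gs. mset gs = S \<and> foldr (\<otimes>\<^bsub>G\<^esub>) gs \<one>\<^bsub>G\<^esub> = \<one>\<^bsub>G\<^esub>)"

definition product_one_free :: "('a, 'b) monoid_scheme \<Rightarrow> 'a multiset \<Rightarrow> bool" where
  "product_one_free G S \<longleftrightarrow> \<not> (\<exists>T. T \<subseteq># S \<and> T \<noteq> {#} \<and> product_one G T)"

text \<open>Meaningful for finite \<open>G\<close>, where the lengths in question are bounded by the order of \<open>G\<close>;
  \<^const>\<open>Max\<close> of an infinite set is unspecified.\<close>

definition small_davenport :: "('a, 'b) monoid_scheme \<Rightarrow> nat" where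
  "small_davenport G = Max {l. \<exists>S. set_mset S \<subseteq> carrier G \<and> size S = l \<and> product_one_free G S}"

end

theory Submission
  imports Defs
begin

text \<open>For the upper bound, let \<open>H = \<langle>y\<rangle>\<close>. The condition on the orders of \<open>s\<close> means that no nontrivial element
  of \<open>H\<close> commutes with an element outside \<open>H\<close>. As long as a product-one free sequence has at least
  \<open>[G : H]\<close> terms, it contains a shortest nonempty subsequence \<open>T\<close> with product in \<open>H\<close>, and the \<open>|T|\<close>
  rotations of \<open>T\<close> have distinct nontrivial products in \<open>H\<close>. Splitting off \<open>T\<close> therefore loses at least
  \<open>|T|\<close> subsequence products in \<open>H\<close>, by the Kemperman--Scherk inequality \<open>|AB| \<ge> |A| + |B| - 1\<close> for
  sets \<open>A\<close>, \<open>B\<close> containing \<open>1\<close> such that \<open>1 = ab\<close> only for \<open>a = b = 1\<close>. Since there are at most \<open>|H|\<close>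
  such products, the sequence has at most \<open>|H| + [G : H] - 2\<close> terms. The sequence of \<open>m - 1\<close> terms \<open>x\<close> and
  \<open>n - 1\<close> terms \<open>y\<close> attains the bound.\<close>

section \<open>The Kemperman--Scherk inequality\<close>

text \<open>Induction on \<open>|B|\<close> by the Dyson transform \<open>A' = A \<union> eB\<close>, \<open>B' = B \<inter> e\<inverse>A\<close>. Some \<open>e \<in> A\<close> makes \<open>B'\<close>
  smaller than \<open>B\<close>, as otherwise \<open>A\<close> contains all powers of some \<open>b \<noteq> 1\<close> in \<open>B\<close>, hence \<open>b\<inverse>\<close>.\<close>

lemma (in comm_group) card_set_mult_ge:
  assumes "finite A" "finite B" "A \<subseteq> carrier G" "B \<subseteq> carrier G" "\<one> \<in> A" "\<one> \<in> B"
    and "\<And>a b. a \<in> A \<Longrightarrow> b \<in> B \<Longrightarrow> a \<otimes> b = \<one> \<Longrightarrow> a = \<one> \<and> b = \<one>"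
  shows "card A + card B \<le> card (A <#> B) + 1"
  using assms
proof (induction "card B" arbitrary: A B rule: less_induct)
  case less
  note fin = less.prems(1,2) and sub = less.prems(3,4) and one = less.prems(5,6)
    and uniq = less.prems(7)
  note [simp] = subsetD[OF sub(1)] subsetD[OF sub(2)]
  show ?case
  proof (cases "B = {\<one>}")
    case True
    have "A <#> B = A"
      using sub unfolding True set_mult_def by force
    then show ?thesis by (simp add: True)
  next
    case False
    then obtain b where b: "b \<in> B" "b \<noteq> \<one>" using one by blast
    have "\<exists>e\<in>A. \<not> (\<lambda>c. e \<otimes> c) ` B \<subseteq> A"
    proof (rule ccontr)
      assume "\<not> ?thesis"
      then have cl: "e \<otimes> b \<in> A" if "e \<in> A" for e
        using that b by blast
      have pow: "b [^] k \<in> A" for k :: nat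
        by (induction k) (simp_all add: one cl)
      then have "range (\<lambda>k::nat. b [^] k) \<subseteq> A" by (rule image_subsetI)
      then have "\<not> inj (\<lambda>k::nat. b [^] k)"
        using fin(1) by (metis finite_subset infinite_UNIV_nat finite_imageD)
      then obtain i j :: nat where ij: "i < j" "b [^] i = b [^] j"
        unfolding inj_on_def by (metis linorder_neqE_nat)
      have "b [^] i \<otimes> b [^] (j - i) = b [^] i \<otimes> \<one>"
        using ij(1) ij(2)[symmetric] b by (simp add: nat_pow_mult)
      then have "b [^] (j - i) = \<one>" using b by (simp del: r_one)
      moreover have "b [^] (j - i) = b [^] (j - i - 1) \<otimes> b"
        using ij by (metis Suc_diff_1 nat_pow_Suc zero_less_diff)
      ultimately show False using uniq[OF pow b(1)] b(2) by metis
    qed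
    then obtain e where e: "e \<in> A" "\<not> (\<lambda>c. e \<otimes> c) ` B \<subseteq> A" by blast
    define A' where "A' = A \<union> (\<lambda>c. e \<otimes> c) ` B"
    define B' where "B' = {c \<in> B. e \<otimes> c \<in> A}"
    have B'sub: "B' \<subset> B" using e unfolding B'_def by blast
    have inj: "inj_on (\<lambda>c. e \<otimes> c) B"
      using e by (auto simp: inj_on_def)
    \<comment> \<open>Hence the transform preserves \<open>card A + card B\<close>: the union gains
      as many elements as the intersection removes from \<open>B\<close>.\<close>
    have "A \<inter> (\<lambda>c. e \<otimes> c) ` B = (\<lambda>c. e \<otimes> c) ` B'"
      unfolding B'_def by blast
    then have "card A + card ((\<lambda>c. e \<otimes> c) ` B) = card A' + card ((\<lambda>c. e \<otimes> c) ` B')"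
      unfolding A'_def using card_Un_Int[of A "(\<lambda>c. e \<otimes> c) ` B"] fin by simp
    then have eq: "card A + card B = card A' + card B'"
      using inj inj_on_subset[OF inj, of B'] B'sub by (simp add: card_image psubset_imp_subset)
    have "card A' + card B' \<le> card (A' <#> B') + 1"
    proof (rule less.hyps)
      show "card B' < card B" using B'sub fin by (simp add: psubset_card_mono)
      show "finite A'" "finite B'" using fin by (simp_all add: A'_def B'_def)
      show "A' \<subseteq> carrier G" "B' \<subseteq> carrier G" using e by (auto simp: A'_def B'_def)
      show "\<one> \<in> A'" "\<one> \<in> B'" using one e by (simp_all add: A'_def B'_def)
      fix a c assume ac: "a \<in> A'" "c \<in> B'" "a \<otimes> c = \<one>"
      then have c: "c \<in> B" "e \<otimes> c \<in> A" by (auto simp: B'_def)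
      show "a = \<one> \<and> c = \<one>"
      proof (cases "a \<in> A")
        case True
        then show ?thesis using uniq ac c by blast
      next
        case False
        then obtain d where d: "d \<in> B" "a = e \<otimes> d" using ac by (auto simp: A'_def)
        \<comment> \<open>Commutativity regroups the product into \<open>e \<otimes> c\<close> from
          \<open>A\<close> and \<open>d\<close> from \<open>B\<close>; uniqueness applies to this
          pair, then to \<open>e\<close> and \<open>c\<close>.\<close>
        have "(e \<otimes> c) \<otimes> d = \<one>" using ac d c e by (simp add: m_ac)
        then have "e \<otimes> c = \<one>" "d = \<one>" using uniq c d by blast+
        moreover from this have "e = \<one>" "c = \<one>" using uniq c e by blast+
        ultimately show ?thesis using d by simp
      qed
    qed
    also have "A' <#> B' \<subseteq> A <#> B"
    proof
      fix z assume "z \<in> A' <#> B'"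
      then obtain a c where ac: "a \<in> A'" "c \<in> B'" "z = a \<otimes> c" unfolding set_mult_def by blast
      then have c: "c \<in> B" "e \<otimes> c \<in> A" by (auto simp: B'_def)
      show "z \<in> A <#> B"
      proof (cases "a \<in> A")
        case True
        then show ?thesis using ac c unfolding set_mult_def by blast
      next
        case False
        then obtain d where d: "d \<in> B" "a = e \<otimes> d" using ac by (auto simp: A'_def)
        have "z = (e \<otimes> c) \<otimes> d" using ac d c e by (simp add: m_ac)
        then show ?thesis using d c unfolding set_mult_def by blast
      qed
    qed
    then have "card (A' <#> B') \<le> card (A <#> B)"
      using fin by (intro card_mono) (simp_all add: set_mult_def)
    finally show ?thesis using eq by linarith
  qed
qed

section \<open>Product-one free sequences and normal subgroups\<close>

abbreviation (in monoid) list_prod :: "'a list \<Rightarrow> 'a" where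
  "list_prod gs \<equiv> foldr (\<otimes>) gs \<one>"

lemma (in monoid) list_prod_closed [simp]: "set gs \<subseteq> carrier G \<Longrightarrow> list_prod gs \<in> carrier G"
  by (induction gs) auto

lemma (in monoid) list_prod_append:
  "set gs \<subseteq> carrier G \<Longrightarrow> set hs \<subseteq> carrier G \<Longrightarrow> list_prod (gs @ hs) = list_prod gs \<otimes> list_prod hs"
  by (induction gs) (auto simp: m_assoc)

lemma product_one_freeD:
  assumes "product_one_free G S" "mset gs \<subseteq># S" "foldr (\<otimes>\<^bsub>G\<^esub>) gs \<one>\<^bsub>G\<^esub> = \<one>\<^bsub>G\<^esub>"
  shows "gs = []"
  using assms unfolding product_one_free_def product_one_def by fastforce

lemma product_one_free_mono: "product_one_free G S \<Longrightarrow> T \<subseteq># S \<Longrightarrow> product_one_free G T"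
  unfolding product_one_free_def using subset_mset.order_trans by blast

text \<open>Every ordering of a subsequence counts, so the rotations of one sequence contribute
  separately. The empty subsequence contributes \<open>\<one>\<close> when \<open>H\<close> is a
  subgroup.\<close>

definition (in monoid) subseq_prods :: "'a set \<Rightarrow> 'a multiset \<Rightarrow> 'a set" where
  "subseq_prods H S = {list_prod gs | gs. mset gs \<subseteq># S \<and> list_prod gs \<in> H}"

text \<open>Pigeonhole on suffix products: with the empty suffix there are \<open>size S + 1\<close>
  of them, so two lie in the same coset of \<open>H\<close>, and the block between them has its
  product in \<open>H\<close>.\<close>

lemma (in group) ex_list_prod_in_subgroup:
  assumes "subgroup H G" "finite (rcosets H)" "set_mset S \<subseteq> carrier G" "card (rcosets H) \<le> size S"
  shows "\<exists>t. t \<noteq> [] \<and> mset t \<subseteq># S \<and> list_prod t \<in> H"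
proof -
  interpret H: subgroup H G by fact
  obtain gs where gs: "mset gs = S" using ex_mset by blast
  have set_gs: "set gs \<subseteq> carrier G" using gs assms(3) by auto
  define p where "p i = list_prod (drop i gs)" for i
  have sub: "set (drop i gs) \<subseteq> carrier G" for i using set_gs set_drop_subset by fast
  have p: "p i \<in> carrier G" for i unfolding p_def using sub by simp
  have "(\<lambda>i. H #> p i) ` {..length gs} \<subseteq> rcosets H"
    using p H.subset by (auto intro: rcosetsI)
  moreover have "card (rcosets H) < card {..length gs}" using assms(4) gs by auto
  ultimately have "\<not> inj_on (\<lambda>i. H #> p i) {..length gs}"
    using card_inj_on_le assms(2) leD by blast
  then obtain i j where ij: "i < j" "j \<le> length gs" "H #> p i = H #> p j"
    unfolding inj_on_def by (metis atMost_iff linorder_neqE_nat)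
  define t where "t = take (j - i) (drop i gs)"
  have d: "drop i gs = t @ drop j gs"
    using ij by (simp add: t_def) (metis append_take_drop_id drop_drop le_add_diff_inverse2 less_imp_le_nat)
  have st: "set t \<subseteq> carrier G" using sub[of i] unfolding d by simp
  have "p i = list_prod t \<otimes> p j"
    unfolding p_def d by (rule list_prod_append[OF st sub])
  moreover have "p i \<in> H #> p j" using ij(3) rcos_self[OF p assms(1)] by metis
  then obtain h where "h \<in> H" "p i = h \<otimes> p j" unfolding r_coset_def by blast
  ultimately have "list_prod t \<in> H"
    using p st H.subset by (metis list_prod_closed r_cancel subsetD)
  moreover have "t \<noteq> []" using ij by (simp add: t_def)
  moreover have "mset t \<subseteq># S"
    by (metis append_take_drop_id d gs mset_append mset_subset_eq_add_left mset_subset_eq_add_right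
        subset_mset.order_trans)
  ultimately show ?thesis by blast
qed

text \<open>If the products of two rotations \<open>v w u\<close> and \<open>w u v\<close> of \<open>t\<close> agree, then \<open>v\<close> commutes with
  this product, which is a conjugate of the product of \<open>t\<close>.\<close>

lemma (in group) inj_on_rotations:
  assumes "H \<lhd> G" "set t \<subseteq> carrier G" "list_prod t \<in> H"
    and ne: "\<And>l. l < length t \<Longrightarrow> list_prod (drop l t @ take l t) \<noteq> \<one>"
    and minimal: "\<And>u v w. t = u @ v @ w \<Longrightarrow> v \<noteq> [] \<Longrightarrow> v \<noteq> t \<Longrightarrow> list_prod v \<notin> H"
    and fpf: "\<And>g h. g \<in> carrier G - H \<Longrightarrow> h \<in> H - {\<one>} \<Longrightarrow> g \<otimes> h \<noteq> h \<otimes> g"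
  shows "(\<lambda>l. list_prod (drop l t @ take l t)) ` {..<length t} \<subseteq> H - {\<one>}"
    and "inj_on (\<lambda>l. list_prod (drop l t @ take l t)) {..<length t}"
proof -
  interpret H: normal H G by fact
  let ?a = "\<lambda>l. list_prod (drop l t @ take l t)"
  have sub: "set (take l t) \<subseteq> carrier G" "set (drop l t) \<subseteq> carrier G" for l
    using assms(2) set_take_subset set_drop_subset by fast+
  have aH: "?a l \<in> H" for l
  proof -
    let ?u = "list_prod (take l t)" and ?v = "list_prod (drop l t)"
    have "list_prod t = ?u \<otimes> ?v"
      using list_prod_append[OF sub(1)[of l] sub(2)[of l]] by simp
    moreover have "?a l = ?v \<otimes> ?u"
      using list_prod_append[OF sub(2)[of l] sub(1)[of l]] by simp
    \<comment> \<open>The product of a rotation is the conjugate of the whole product by that of the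
      prefix, so normality keeps it in \<open>H\<close>.\<close>
    moreover have "inv ?u \<otimes> (?u \<otimes> ?v) \<otimes> ?u = ?v \<otimes> ?u"
      using sub by (simp add: inv_solve_left' m_assoc)
    ultimately show ?thesis using H.inv_op_closed1[OF list_prod_closed[OF sub(1)] assms(3)] by metis
  qed
  show *: "?a ` {..<length t} \<subseteq> H - {\<one>}"
  proof (rule image_subsetI)
    fix l assume "l \<in> {..<length t}"
    then show "?a l \<in> H - {\<one>}" using ne[of l] aH[of l] by (simp only: lessThan_iff) blast
  qed
  have neq: "?a l \<noteq> ?a k" if "l < k" "k < length t" for l k
  proof
    assume eq: "?a l = ?a k"
    define u v w where "u = take l t" and "v = take (k - l) (drop l t)" and "w = drop k t"
    have t: "t = u @ v @ w"
    proof -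
      have "drop (k - l) (drop l t) = w" using that by (simp add: w_def)
      then show ?thesis unfolding u_def v_def by (metis append_take_drop_id)
    qed
    have len: "length u = l" "length v = k - l" using that by (auto simp: u_def v_def)
    have s: "set u \<subseteq> carrier G" "set v \<subseteq> carrier G" "set w \<subseteq> carrier G"
      using assms(2) unfolding t by auto
    \<comment> \<open>Even for \<open>l = 0\<close> the block \<open>v\<close> is proper, because
      \<open>k < length t\<close>; minimality then puts its product outside
      \<open>H\<close>.\<close>
    have v: "list_prod v \<in> carrier G - H"
    proof -
      have "v \<noteq> []" "length v \<noteq> length t" using len that by auto
      then show ?thesis using minimal[OF t] s by auto
    qed
    have al: "?a l = list_prod v \<otimes> (list_prod w \<otimes> list_prod u)"
      using s len that by (simp add: t list_prod_append m_assoc del: foldr_append)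
    have ak: "?a k = (list_prod w \<otimes> list_prod u) \<otimes> list_prod v"
      using s len that by (simp add: t list_prod_append m_assoc del: foldr_append)
    have "list_prod v \<otimes> ?a l = ?a l \<otimes> list_prod v"
      using al ak eq s by (metis list_prod_closed m_assoc m_closed)
    moreover have "?a l \<in> H - {\<one>}"
      using that by (intro subsetD[OF *] imageI) simp
    ultimately show False using fpf[OF v] by blast
  qed
  show "inj_on ?a {..<length t}"
    by (rule inj_onI) (metis lessThan_iff neq linorder_neqE_nat)
qed

text \<open>The bound counts the products that occur instead of all of \<open>H\<close>, because
  this count drops by at least \<open>length t\<close> when \<open>t\<close> is split off, which
  drives the induction on \<open>size S\<close>.\<close>

lemma (in group) size_le_card_subseq_prods:
  assumes H: "H \<lhd> G" "finite H" "finite (rcosets H)"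
    and comm: "\<And>g h. g \<in> H \<Longrightarrow> h \<in> H \<Longrightarrow> g \<otimes> h = h \<otimes> g"
    and fpf: "\<And>g h. g \<in> carrier G - H \<Longrightarrow> h \<in> H - {\<one>} \<Longrightarrow> g \<otimes> h \<noteq> h \<otimes> g"
    and S: "set_mset S \<subseteq> carrier G" "product_one_free G S"
  shows "size S + 2 \<le> card (subseq_prods H S) + card (rcosets H)"
  using S
proof (induction "size S" arbitrary: S rule: less_induct)
  case less
  interpret H: normal H G by fact
  have subH: "subseq_prods H T \<subseteq> H" for T unfolding subseq_prods_def by blast
  have one: "\<one> \<in> subseq_prods H T" for T
    unfolding subseq_prods_def using H.one_closed by (auto intro!: exI[of _ "[]"])
  have finP: "finite (subseq_prods H T)" for T using subH H(2) finite_subset by blast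
  show ?case
  proof (cases "size S < card (rcosets H)")
    case True
    \<comment> \<open>The empty product already gives a count of one, enough when
      \<open>size S + 1 \<le> card (rcosets H)\<close>.\<close>
    have "card (subseq_prods H S) \<noteq> 0" using one[of S] finP[of S] by auto
    then show ?thesis using True by linarith
  next
    case False
    let ?P = "\<lambda>t. t \<noteq> [] \<and> mset t \<subseteq># S \<and> list_prod t \<in> H"
    have "\<exists>t. ?P t"
      using ex_list_prod_in_subgroup[OF H.subgroup_axioms H(3) less.prems(1)] False by simp
    then obtain t where t: "?P t" and t_min: "\<And>v. ?P v \<Longrightarrow> length t \<le> length v"
      using ex_has_least_nat[of ?P _ length] by blast
    define S' where "S' = S - mset t"
    have S': "S = S' + mset t" using t by (simp add: S'_def)
    have st: "set t \<subseteq> carrier G" using less.prems(1) by (auto simp: S')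
    let ?a = "\<lambda>l. list_prod (drop l t @ take l t)"
    have mrot: "mset (drop l t @ take l t) = mset t" for l
      by (metis add.commute append_take_drop_id mset_append)
    have ne: "?a l \<noteq> \<one>" if "l < length t" for l
      using product_one_freeD[OF less.prems(2), of "drop l t @ take l t"] mrot[of l] t
      by (metis mset_zero_iff)
    have minimal: "list_prod v \<notin> H" if "t = u @ v @ w" "v \<noteq> []" "v \<noteq> t" for u v w
    proof
      assume "list_prod v \<in> H"
      moreover have "mset v \<subseteq># S"
        using that t by (metis mset_append mset_subset_eq_add_left mset_subset_eq_add_right
            subset_mset.order_trans)
      ultimately have "length t \<le> length v" using t_min that by blast
      then show False using that by auto
    qed
    \<comment> \<open>Here \<open>\<one>\<close> comes from the empty subsequence of
      \<open>t\<close> and the other \<open>length t\<close> elements from rearrangements of all of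
      \<open>t\<close>.\<close>
    define B where "B = insert \<one> (?a ` {..<length t})"
    have tH: "list_prod t \<in> H" using t by blast
    have aH: "?a ` {..<length t} \<subseteq> H - {\<one>}"
      by (rule inj_on_rotations(1)[OF H(1) st tH ne]) (assumption, erule (2) minimal, erule (1) fpf)
    have inj: "inj_on ?a {..<length t}"
      by (rule inj_on_rotations(2)[OF H(1) st tH ne]) (assumption, erule (2) minimal, erule (1) fpf)
    have cardB: "card B = Suc (length t)"
      unfolding B_def using aH inj by (subst card_insert_disjoint) (auto simp: card_image)
    have BH: "B \<subseteq> H" using aH H.one_closed unfolding B_def by blast
    have B_elem: "\<exists>v. mset v \<subseteq># mset t \<and> b = list_prod v" if bB: "b \<in> B" for b
    proof (cases "b = \<one>")
      case True
      then show ?thesis by (auto intro!: exI[of _ "[]"])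
    next
      case False
      then obtain l where "b = ?a l" using bB unfolding B_def by blast
      then show ?thesis using mrot[of l] by (metis subset_mset.order_refl)
    qed
    have P_elem: "\<exists>u. mset u \<subseteq># S' \<and> a = list_prod u" if "a \<in> subseq_prods H S'" for a
      using that unfolding subseq_prods_def by blast
    have comb: "mset (u @ v) \<subseteq># S \<and> list_prod (u @ v) = list_prod u \<otimes> list_prod v"
      if "mset u \<subseteq># S'" "mset v \<subseteq># mset t" for u v
    proof
      show "mset (u @ v) \<subseteq># S" using that by (simp add: S' subset_mset.add_mono)
      have "set u \<subseteq> carrier G" "set v \<subseteq> carrier G"
        using that[THEN set_mset_mono] less.prems(1) st by (auto simp: S')
      then show "list_prod (u @ v) = list_prod u \<otimes> list_prod v" by (rule list_prod_append)
    qed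
    interpret HG: comm_group "G\<lparr>carrier := H\<rparr>"
      using subgroup_imp_group[OF H.subgroup_axioms] comm by (intro group.group_comm_groupI) auto
    have "card (subseq_prods H S') + card B \<le> card (subseq_prods H S' <#>\<^bsub>G\<lparr>carrier := H\<rparr>\<^esub> B) + 1"
    proof (rule HG.card_set_mult_ge)
      show "finite (subseq_prods H S')" by (rule finP)
      show "finite B" by (simp add: B_def)
      show "subseq_prods H S' \<subseteq> carrier (G\<lparr>carrier := H\<rparr>)" using subH by simp
      show "B \<subseteq> carrier (G\<lparr>carrier := H\<rparr>)" using BH by simp
      show "\<one>\<^bsub>G\<lparr>carrier := H\<rparr>\<^esub> \<in> subseq_prods H S'" using one by simp
      show "\<one>\<^bsub>G\<lparr>carrier := H\<rparr>\<^esub> \<in> B" by (simp add: B_def)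
      fix a b assume "a \<in> subseq_prods H S'" "b \<in> B" and ab: "a \<otimes>\<^bsub>G\<lparr>carrier := H\<rparr>\<^esub> b = \<one>\<^bsub>G\<lparr>carrier := H\<rparr>\<^esub>"
      then obtain u v where uv: "mset u \<subseteq># S'" "a = list_prod u" "mset v \<subseteq># mset t" "b = list_prod v"
        using P_elem B_elem by blast
      \<comment> \<open>Otherwise \<open>u @ v\<close> would be a nonempty product-one subsequence
        of \<open>S\<close>.\<close>
      then have "u @ v = []"
        using comb[OF uv(1,3)] ab product_one_freeD[OF less.prems(2), of "u @ v"] by simp
      then show "a = \<one>\<^bsub>G\<lparr>carrier := H\<rparr>\<^esub> \<and> b = \<one>\<^bsub>G\<lparr>carrier := H\<rparr>\<^esub>" using uv by simp
    qed
    also have "subseq_prods H S' <#>\<^bsub>G\<lparr>carrier := H\<rparr>\<^esub> B \<subseteq> subseq_prods H S"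
    proof
      fix z assume "z \<in> subseq_prods H S' <#>\<^bsub>G\<lparr>carrier := H\<rparr>\<^esub> B"
      then obtain a b where ab: "a \<in> subseq_prods H S'" "b \<in> B" "z = a \<otimes> b"
        unfolding set_mult_def by auto
      then obtain u v where uv: "mset u \<subseteq># S'" "a = list_prod u" "mset v \<subseteq># mset t" "b = list_prod v"
        using P_elem B_elem by blast
      have "z \<in> H" using ab subH BH H.m_closed by blast
      then show "z \<in> subseq_prods H S"
        unfolding subseq_prods_def using comb[OF uv(1,3)] uv ab by (auto intro!: exI[of _ "u @ v"])
    qed
    then have "card (subseq_prods H S' <#>\<^bsub>G\<lparr>carrier := H\<rparr>\<^esub> B) \<le> card (subseq_prods H S)"
      using finP card_mono by blast
    \<comment> \<open>The element \<open>\<one>\<close> of \<open>B\<close> cancels the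
      \<open>+ 1\<close> of the inequality.\<close>
    finally have "card (subseq_prods H S') + length t \<le> card (subseq_prods H S)"
      using cardB by simp
    moreover have "size S' + 2 \<le> card (subseq_prods H S') + card (rcosets H)"
      using less.prems t product_one_free_mono[of G S S'] by (intro less.hyps) (auto simp: S')
    ultimately show ?thesis by (simp add: S')
  qed
qed

lemma (in group) size_product_one_free_le:
  assumes H: "H \<lhd> G" "finite H" "finite (rcosets H)"
    and "\<And>g h. g \<in> H \<Longrightarrow> h \<in> H \<Longrightarrow> g \<otimes> h = h \<otimes> g"
    and "\<And>g h. g \<in> carrier G - H \<Longrightarrow> h \<in> H - {\<one>} \<Longrightarrow> g \<otimes> h \<noteq> h \<otimes> g"
    and "set_mset S \<subseteq> carrier G" "product_one_free G S"
  shows "size S + 2 \<le> card H + card (rcosets H)"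
proof -
  have "card (subseq_prods H S) \<le> card H"
    using H(2) by (intro card_mono) (auto simp: subseq_prods_def)
  then show ?thesis using size_le_card_subseq_prods[OF assms] by simp
qed

section \<open>The upper bound for metacyclic groups\<close>

lemma (in monoid) pow_mod_exponent:
  fixes k i :: nat
  assumes "a \<in> carrier G" "a [^] k = \<one>"
  shows "a [^] (i mod k) = a [^] i"
proof -
  have "a [^] i = (a [^] k) [^] (i div k) \<otimes> a [^] (i mod k)"
    using assms(1) by (simp add: nat_pow_pow nat_pow_mult)
  then show ?thesis using assms by simp
qed

lemma (in monoid) pow_mult_pow_swap:
  fixes i j r :: nat
  assumes [simp]: "x \<in> carrier G" "y \<in> carrier G" and yx: "y \<otimes> x = x \<otimes> y [^] r"
  shows "y [^] j \<otimes> x [^] i = x [^] i \<otimes> y [^] (j * r ^ i)"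
proof -
  have step: "y [^] j \<otimes> x = x \<otimes> y [^] (j * r)" for j :: nat
  proof (induction j)
    case (Suc j)
    have "y [^] Suc j \<otimes> x = (y [^] j \<otimes> x) \<otimes> y [^] r"
      by (simp add: m_assoc yx)
    then show ?case by (simp add: Suc m_assoc nat_pow_mult add.commute)
  qed simp
  show ?thesis
  proof (induction i)
    case (Suc i)
    have "y [^] j \<otimes> x [^] Suc i = x [^] i \<otimes> (y [^] (j * r ^ i) \<otimes> x)"
      using Suc by (simp flip: m_assoc)
    then show ?case by (simp add: step m_assoc mult_ac)
  qed simp
qed

text \<open>The general bound is applied to the powers of \<open>y\<close>. Coprimality of
  \<open>r ^ i - 1\<close> and \<open>n\<close> excludes commuting pairs; the sizes enter only
  through \<open>card H \<le> n\<close> and \<open>card (rcosets H) \<le> m\<close>.\<close>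

lemma (in group) size_product_one_free_le_metacyclic:
  fixes m n r :: nat
  assumes x: "x \<in> carrier G" "x [^] m = \<one>" "m > 0"
    and y: "y \<in> carrier G" "y [^] n = \<one>" "n > 0"
    and yx: "y \<otimes> x = x \<otimes> y [^] r"
    and gen: "\<And>g. g \<in> carrier G \<Longrightarrow> \<exists>(i::nat) (j::nat). g = x [^] i \<otimes> y [^] j"
    and cop: "\<And>i. \<not> m dvd i \<Longrightarrow> coprime (int r ^ i - 1) (int n)"
    and S: "set_mset S \<subseteq> carrier G" "product_one_free G S"
  shows "size S + 2 \<le> n + m"
proof -
  note [simp] = x(1) y(1)
  have comm: "y [^] j \<otimes> x [^] i = x [^] i \<otimes> y [^] (j * r ^ i)" for i j :: nat
    using x(1) y(1) yx by (rule pow_mult_pow_swap)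
  define H where "H = range (\<lambda>j::nat. y [^] j)"
  have xmod: "x [^] i = x [^] (i mod m)" and ymod: "y [^] j = y [^] (j mod n)" for i j
    using x y by (metis pow_mod_exponent)+
  have Himg: "H = (\<lambda>j. y [^] j) ` {..<n}"
    unfolding H_def using ymod y(3) by (auto intro!: image_eqI[of _ _ "_ mod n"])
  have finH: "finite H" and cardH: "card H \<le> n"
    unfolding Himg using card_image_le[of "{..<n}"] by auto
  have subH: "subgroup H G"
  proof (rule subgroupI)
    show "H \<subseteq> carrier G" "H \<noteq> {}" by (auto simp: H_def)
    fix a assume "a \<in> H"
    then obtain j :: nat where j: "a = y [^] j" by (auto simp: H_def)
    have "y [^] (j * (n - 1)) \<otimes> a = (y [^] n) [^] j"
      unfolding j using y(3) by (simp add: nat_pow_mult nat_pow_pow algebra_simps)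
    then have "inv a = y [^] (j * (n - 1))"
      using y j by (intro inv_equality) auto
    then show "inv a \<in> H" by (simp add: H_def)
    fix b assume "b \<in> H"
    then show "a \<otimes> b \<in> H" using j by (auto simp: H_def nat_pow_mult)
  qed
  \<comment> \<open>Conjugation of a power of \<open>y\<close> by an arbitrary element in normal
    form; both normality of \<open>H\<close> and the test for commuting pairs rest on it.\<close>
  have swap: "y [^] b \<otimes> (x [^] i \<otimes> y [^] j) = (x [^] i \<otimes> y [^] j) \<otimes> y [^] (b * r ^ i)" for b i j :: nat
  proof -
    have "y [^] b \<otimes> (x [^] i \<otimes> y [^] j) = x [^] i \<otimes> (y [^] (b * r ^ i) \<otimes> y [^] j)"
      using comm[of b i] by (simp flip: m_assoc)
    also have "y [^] (b * r ^ i) \<otimes> y [^] j = y [^] j \<otimes> y [^] (b * r ^ i)"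
      by (simp add: nat_pow_mult add.commute)
    finally show ?thesis by (simp add: m_assoc)
  qed
  have "g \<otimes> h \<otimes> inv g \<in> H" if gh: "g \<in> carrier G" "h \<in> H" for g h
  proof -
    \<comment> \<open>The normal form is taken for \<open>inv g\<close>, since \<open>swap\<close>
      moves \<open>h\<close> to the right past \<open>inv g\<close>, which then cancels against
      \<open>g\<close>.\<close>
    obtain i j :: nat where ij: "inv g = x [^] i \<otimes> y [^] j" using gen[OF inv_closed[OF gh(1)]] by blast
    obtain b :: nat where b: "h = y [^] b" using gh(2) by (auto simp: H_def)
    have "g \<otimes> h \<otimes> inv g = g \<otimes> (inv g \<otimes> y [^] (b * r ^ i))"
      using swap[of b i j] that b ij by (simp add: m_assoc)
    also have "\<dots> = y [^] (b * r ^ i)"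
      using that by (simp flip: m_assoc)
    finally show ?thesis by (simp add: H_def)
  qed
  then have normal: "H \<lhd> G" using subH by (simp add: normal_inv_iff)
  interpret H: normal H G by fact
  have rcosets: "rcosets H \<subseteq> (\<lambda>i. H #> x [^] i) ` {..<m}"
  proof
    fix C assume "C \<in> rcosets H"
    then obtain g where g: "g \<in> carrier G" "C = H #> g" by (auto simp: RCOSETS_def)
    obtain i j :: nat where ij: "g = x [^] i \<otimes> y [^] j" using gen[OF g(1)] by blast
    have "x [^] i \<otimes> y [^] j \<otimes> inv (x [^] i) \<in> H"
      by (rule H.inv_op_closed2) (auto simp: H_def)
    moreover have "g = (x [^] i \<otimes> y [^] j \<otimes> inv (x [^] i)) \<otimes> x [^] i"
      using ij by (simp add: m_assoc)
    ultimately have "g \<in> H #> x [^] i" unfolding r_coset_def by blast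
    then have "H #> x [^] i = H #> g"
      by (intro repr_independence subH) auto
    then have "C = H #> x [^] (i mod m)" using g xmod by metis
    then show "C \<in> (\<lambda>i. H #> x [^] i) ` {..<m}" using x(3) by auto
  qed
  have "card (rcosets H) \<le> card ((\<lambda>i. H #> x [^] i) ` {..<m})"
    using rcosets by (intro card_mono) auto
  then have index: "card (rcosets H) \<le> m"
    using card_image_le[of "{..<m}" "\<lambda>i. H #> x [^] i"] by simp
  have "size S + 2 \<le> card H + card (rcosets H)"
  proof (rule size_product_one_free_le[OF normal finH _ _ _ S])
    show "finite (rcosets H)" using rcosets finite_subset by blast
    show "g \<otimes> h = h \<otimes> g" if "g \<in> H" "h \<in> H" for g h
      using that by (auto simp: H_def nat_pow_mult add.commute)
    show "g \<otimes> h \<noteq> h \<otimes> g" if gh: "g \<in> carrier G - H" "h \<in> H - {\<one>}" for g h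
    proof
      assume eq: "g \<otimes> h = h \<otimes> g"
      obtain i j :: nat where ij: "g = x [^] i \<otimes> y [^] j" using gen[of g] gh by blast
      obtain b :: nat where b: "h = y [^] b" using gh by (auto simp: H_def)
      have "\<not> m dvd i"
      proof
        assume "m dvd i"
        then have "x [^] i = \<one>" using xmod[of i] by simp
        then show False using gh ij by (simp add: H_def)
      qed
      then have cop_i: "coprime (int r ^ i - 1) (int n)" by (rule cop)
      have "g \<otimes> y [^] b = g \<otimes> y [^] (b * r ^ i)" using eq swap[of b i j] ij b by simp
      then have "y [^] (b * r ^ i) = y [^] b" using gh by simp
      then have "y [^] int (b * r ^ i) = y [^] int b" by (simp only: int_pow_int)
      \<comment> \<open>The order of \<open>y\<close> divides \<open>b * (r ^ i - 1)\<close>. Being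
        a divisor of \<open>n\<close>, it is coprime to the second factor, so it divides
        \<open>b\<close> and \<open>h\<close> is trivial.\<close>
      then have "int (local.ord y) dvd int b - int b * int r ^ i"
        by (simp add: int_pow_eq)
      then have "int (local.ord y) dvd int b * (int r ^ i - 1)"
        by (subst dvd_minus_iff[symmetric]) (simp add: algebra_simps)
      moreover have "int (local.ord y) dvd int n" using y pow_eq_id by simp
      then have "coprime (int (local.ord y)) (int r ^ i - 1)"
        using cop_i by (meson coprime_commute coprime_divisors dvd_refl)
      ultimately have "local.ord y dvd b"
        by (simp add: coprime_dvd_mult_left_iff)
      then show False using b gh pow_eq_id by simp
    qed
  qed
  then show ?thesis using cardH index by linarith
qed

section \<open>Presented groups\<close>

lemma word_class_Nil: "word_class R [] = \<one>\<^bsub>presented_group R\<^esub>"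
  by (simp add: presented_group_def)

lemma word_class_closed [simp]: "word_class R u \<in> carrier (presented_group R)"
  by (simp add: presented_group_carrier)

lemma word_class_inverse_letter:
  "word_class R [(a, False)] = inv\<^bsub>presented_group R\<^esub> word_class R [(a, True)]"
proof -
  interpret group "presented_group R" by (rule group_presented_group)
  have "word_class R [(a, False)] \<otimes>\<^bsub>presented_group R\<^esub> word_class R [(a, True)] = \<one>\<^bsub>presented_group R\<^esub>"
    using word_cong.cancel[of R a False]
    by (simp add: presented_group_mult word_class_eq_iff flip: word_class_Nil)
  then show ?thesis by (intro inv_equality[symmetric]) auto
qed

lemma word_class_replicate:
  "word_class R (replicate k p) = word_class R [p] [^]\<^bsub>presented_group R\<^esub> k"
proof (induction k)
  case (Suc k)
  have "word_class R (replicate (Suc k) p) = word_class R (replicate k p @ [p])"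
    by (simp only: replicate_append_same replicate_Suc)
  then show ?case
    using Suc by (simp add: monoid.nat_pow_Suc group.is_monoid[OF group_presented_group]
        flip: presented_group_mult)
qed (simp add: word_class_Nil)

lemma word_class_gen_pow:
  "word_class R (gen_pow a k) = word_class R [(a, True)] [^]\<^bsub>presented_group R\<^esub> k"
proof -
  interpret group "presented_group R" by (rule group_presented_group)
  show ?thesis
  proof (cases "k \<ge> 0")
    case True
    then show ?thesis by (simp add: gen_pow_def word_class_replicate pow_nat)
  next
    case False
    then have "k = - int (nat \<bar>k\<bar>)" by simp
    then have "word_class R [(a, True)] [^]\<^bsub>presented_group R\<^esub> k =
        inv\<^bsub>presented_group R\<^esub> (word_class R [(a, True)] [^]\<^bsub>presented_group R\<^esub> nat \<bar>k\<bar>)"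
      by (metis int_pow_int int_pow_neg word_class_closed)
    then show ?thesis
      using False unfolding gen_pow_def
      by (simp only: word_class_replicate word_class_inverse_letter nat_pow_inv word_class_closed if_False simp_thms)
  qed
qed

lemma foldr_mult_word_class:
  "foldr (\<otimes>\<^bsub>presented_group R\<^esub>) (map (word_class R) us) \<one>\<^bsub>presented_group R\<^esub> = word_class R (concat us)"
  by (induction us) (simp_all add: word_class_Nil presented_group_mult)

section \<open>The groups \<open>\<langle>x, y | x\<^sup>m = y\<^sup>n = 1, x\<inverse> y x = y\<^sup>s\<rangle>\<close>\<close>

definition G_star_relations :: "nat \<Rightarrow> nat \<Rightarrow> int \<Rightarrow> (gen word \<times> gen word) set" where
  "G_star_relations m n s =
    {(gen_pow gen_x (int m), []),
     (gen_pow gen_y (int n), []),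
     (gen_pow gen_x (- 1) @ gen_pow gen_y 1 @ gen_pow gen_x 1, gen_pow gen_y s)}"

lemma G_star_eq: "G_star m n s = presented_group (G_star_relations m n s)"
  by (simp add: G_star_def G_star_relations_def)

section \<open>Orders of \<open>s\<close> modulo \<open>n\<close> and modulo its prime
  divisors\<close>

lemma pow_cong_iff_cong_nat_pow:
  fixes s :: int and n d :: nat
  assumes "n > 0"
  shows "[s ^ d = 1] (mod int n) \<longleftrightarrow> [nat (s mod int n) ^ d = 1] (mod n)"
proof -
  have "[nat (s mod int n) ^ d = 1] (mod n) \<longleftrightarrow> [(s mod int n) ^ d = 1] (mod int n)"
    using assms by (simp flip: cong_int_iff)
  then show ?thesis by (simp add: cong_def power_mod)
qed

text \<open>Passing to the residue of \<open>s\<close> moves the order to the natural numbers, where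
  \<open>ord_divides\<close> is applied. Coprimality is compared as well because the definition of
  \<open>ord\<close> branches on it.\<close>

lemma ord_int_eq_ord_nat:
  assumes "n > 0"
  shows "ord (int n) s = ord n (nat (s mod int n))"
proof -
  have "coprime (int n) s \<longleftrightarrow> coprime (int n) (int (nat (s mod int n)))"
    using assms by simp
  then have "coprime (int n) s \<longleftrightarrow> coprime n (nat (s mod int n))"
    by (simp only: coprime_int_iff)
  then show ?thesis
    by (simp add: ord_def pow_cong_iff_cong_nat_pow[OF assms])
qed

lemma ord_int_divides:
  assumes "n > 0"
  shows "[s ^ d = 1] (mod int n) \<longleftrightarrow> ord (int n) s dvd d"
  by (simp only: pow_cong_iff_cong_nat_pow[OF assms] ord_int_eq_ord_nat[OF assms] ord_divides)

text \<open>A common prime divisor \<open>p\<close> would give \<open>s ^ i\<close> congruent to 1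
  modulo \<open>p\<close>, so the order \<open>m\<close> of \<open>s\<close> modulo \<open>p\<close>
  would divide \<open>i\<close>.\<close>

lemma coprime_power_minus_one:
  fixes s :: int and n m i :: nat
  assumes "n > 0" "\<And>q. Factorial_Ring.prime q \<Longrightarrow> q dvd n \<Longrightarrow> ord (int q) s = m" "\<not> m dvd i"
  shows "coprime (s ^ i - 1) (int n)"
proof (rule ccontr)
  assume "\<not> ?thesis"
  then have "nat (gcd (s ^ i - 1) (int n)) \<noteq> 1"
    unfolding coprime_iff_gcd_eq_1 by linarith
  then obtain p where p: "Factorial_Ring.prime p" "p dvd nat (gcd (s ^ i - 1) (int n))"
    using prime_factor_nat by blast
  then have "int p dvd int (nat (gcd (s ^ i - 1) (int n)))" by (simp only: int_dvd_int_iff)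
  then have "int p dvd gcd (s ^ i - 1) (int n)" by simp
  then have *: "int p dvd s ^ i - 1" "p dvd n" by simp_all
  then have "[s ^ i = 1] (mod int p)" by (simp add: cong_iff_dvd_diff)
  then have "ord (int p) s dvd i"
    using p by (simp add: ord_int_divides prime_gt_0_nat)
  then show False using assms * p by simp
qed

text \<open>The presented group satisfies the assumptions of the metacyclic bound: words reach
  normal form letter by letter, each new power of \<open>x\<close> being moved left past the powers
  of \<open>y\<close>.\<close>

lemma size_product_one_free_G_star_le:
  fixes m n :: nat and s :: int
  assumes mn: "m > 0" "n > 0"
    and prime: "\<And>q. Factorial_Ring.prime q \<Longrightarrow> q dvd n \<Longrightarrow> ord (int q) s = m"
    and S: "set_mset S \<subseteq> carrier (G_star m n s)" "product_one_free (G_star m n s) S"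
  shows "size S + 2 \<le> n + m"
proof -
  define R where "R = G_star_relations m n s"
  let ?G = "presented_group R"
  let ?x = "word_class R [(gen_x, True)]" and ?y = "word_class R [(gen_y, True)]"
  interpret group ?G by (rule group_presented_group)
  have "word_cong R u v" if "(u, v) \<in> G_star_relations m n s" for u v
    using that by (auto simp: R_def intro: word_cong.rel)
  then have rel: "word_class R u = word_class R v" if "(u, v) \<in> G_star_relations m n s" for u v
    using that by (simp add: word_class_eq_iff)
  have x: "?x [^]\<^bsub>?G\<^esub> m = \<one>\<^bsub>?G\<^esub>"
    using rel[of "gen_pow gen_x (int m)" "[]"]
    by (simp add: G_star_relations_def word_class_gen_pow word_class_Nil int_pow_int)
  have y: "?y [^]\<^bsub>?G\<^esub> n = \<one>\<^bsub>?G\<^esub>"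
    using rel[of "gen_pow gen_y (int n)" "[]"]
    by (simp add: G_star_relations_def word_class_gen_pow word_class_Nil int_pow_int)
  \<comment> \<open>The integer \<open>s\<close> may be negative; since \<open>y\<close> has
    exponent \<open>n\<close>, its residue serves as a natural exponent.\<close>
  define r where "r = nat (s mod int n)"
  have r: "int r = s mod int n" using mn by (simp add: r_def)
  have "?y [^]\<^bsub>?G\<^esub> s = (?y [^]\<^bsub>?G\<^esub> int n) [^]\<^bsub>?G\<^esub> (s div int n) \<otimes>\<^bsub>?G\<^esub> ?y [^]\<^bsub>?G\<^esub> int r"
    unfolding r by (simp add: int_pow_pow flip: int_pow_mult)
  then have ys: "?y [^]\<^bsub>?G\<^esub> s = ?y [^]\<^bsub>?G\<^esub> r"
    by (simp add: int_pow_int y)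
  have "inv\<^bsub>?G\<^esub> ?x \<otimes>\<^bsub>?G\<^esub> (?y \<otimes>\<^bsub>?G\<^esub> ?x) = word_class R (gen_pow gen_x (- 1) @ gen_pow gen_y 1 @ gen_pow gen_x 1)"
    by (simp add: gen_pow_def presented_group_mult flip: word_class_inverse_letter)
  also have "\<dots> = ?y [^]\<^bsub>?G\<^esub> r"
    using rel[of "gen_pow gen_x (- 1) @ gen_pow gen_y 1 @ gen_pow gen_x 1" "gen_pow gen_y s"] ys
    by (simp add: G_star_relations_def word_class_gen_pow)
  finally have yx: "?y \<otimes>\<^bsub>?G\<^esub> ?x = ?x \<otimes>\<^bsub>?G\<^esub> ?y [^]\<^bsub>?G\<^esub> r"
    by (simp add: inv_solve_left')
  \<comment> \<open>Inverse letters become natural powers, so normal forms need only natural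
    exponents.\<close>
  have inverse_pow: "inv\<^bsub>?G\<^esub> a = a [^]\<^bsub>?G\<^esub> (k - 1)"
    if "a \<in> carrier ?G" "a [^]\<^bsub>?G\<^esub> k = \<one>\<^bsub>?G\<^esub>" "k > 0" for a and k :: nat
    using that by (intro inv_equality) (simp_all flip: nat_pow_Suc)
  have letter: "(\<exists>k::nat. word_class R [p] = ?x [^]\<^bsub>?G\<^esub> k) \<or> (\<exists>k::nat. word_class R [p] = ?y [^]\<^bsub>?G\<^esub> k)" for p
  proof -
    obtain a e where p: "p = (a, e)" by (cases p)
    have "\<exists>k::nat. word_class R [p] = word_class R [(a, True)] [^]\<^bsub>?G\<^esub> k"
    proof (cases e)
      case True
      then show ?thesis by (intro exI[of _ 1]) (simp add: p)
    next
      case False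
      then show ?thesis
        using inverse_pow[OF _ x mn(1)] inverse_pow[OF _ y mn(2)]
        by (cases a) (auto simp: p word_class_inverse_letter)
    qed
    then show ?thesis by (cases a) auto
  qed
  have gen: "\<exists>(i::nat) (j::nat). g = ?x [^]\<^bsub>?G\<^esub> i \<otimes>\<^bsub>?G\<^esub> ?y [^]\<^bsub>?G\<^esub> j" if "g \<in> carrier ?G" for g
  proof -
    have "\<exists>(i::nat) (j::nat). word_class R u = ?x [^]\<^bsub>?G\<^esub> i \<otimes>\<^bsub>?G\<^esub> ?y [^]\<^bsub>?G\<^esub> j" for u
    proof (induction u rule: rev_induct)
      case Nil
      show ?case by (rule exI[of _ 0], rule exI[of _ 0]) (simp add: word_class_Nil)
    next
      case (snoc p u)
      then obtain i j :: nat where ij: "word_class R u = ?x [^]\<^bsub>?G\<^esub> i \<otimes>\<^bsub>?G\<^esub> ?y [^]\<^bsub>?G\<^esub> j" by blast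
      have eq: "word_class R (u @ [p]) = ?x [^]\<^bsub>?G\<^esub> i \<otimes>\<^bsub>?G\<^esub> (?y [^]\<^bsub>?G\<^esub> j \<otimes>\<^bsub>?G\<^esub> word_class R [p])"
        using ij by (simp add: m_assoc flip: presented_group_mult)
      from letter[of p] show ?case
      proof
        assume "\<exists>k::nat. word_class R [p] = ?x [^]\<^bsub>?G\<^esub> k"
        then obtain k :: nat where "word_class R [p] = ?x [^]\<^bsub>?G\<^esub> k" by blast
        then have "word_class R (u @ [p]) = ?x [^]\<^bsub>?G\<^esub> (i + k) \<otimes>\<^bsub>?G\<^esub> ?y [^]\<^bsub>?G\<^esub> (j * r ^ k)"
          using pow_mult_pow_swap[OF _ _ yx, of j k] eq by (simp flip: nat_pow_mult m_assoc)
        then show ?thesis by blast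
      next
        assume "\<exists>k::nat. word_class R [p] = ?y [^]\<^bsub>?G\<^esub> k"
        then obtain k :: nat where "word_class R [p] = ?y [^]\<^bsub>?G\<^esub> k" by blast
        then have "word_class R (u @ [p]) = ?x [^]\<^bsub>?G\<^esub> i \<otimes>\<^bsub>?G\<^esub> ?y [^]\<^bsub>?G\<^esub> (j + k)"
          using eq by (simp flip: nat_pow_mult)
        then show ?thesis by blast
      qed
    qed
    then show ?thesis using that by (auto simp: presented_group_carrier)
  qed
  have cop: "coprime (int r ^ i - 1) (int n)" if "\<not> m dvd i" for i
  proof -
    have "[int r ^ i - 1 = s ^ i - 1] (mod int n)"
      unfolding r by (intro cong_diff cong_pow cong_refl) (simp add: cong_def)
    moreover have "coprime (s ^ i - 1) (int n)"
      by (rule coprime_power_minus_one[OF mn(2) prime that])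
    ultimately show ?thesis using cong_imp_coprime cong_sym by blast
  qed
  show ?thesis
    using size_product_one_free_le_metacyclic[OF _ x mn(1) _ y mn(2) yx gen cop] S
    by (simp add: G_star_eq R_def)
qed

section \<open>Invariants of words for the lower bound\<close>

fun exponent_x :: "gen \<times> bool \<Rightarrow> int" where
  "exponent_x (gen_x, e) = (if e then 1 else - 1)"
| "exponent_x (gen_y, e) = 0"

lemma sum_list_exponent_x:
  "sum_list (map exponent_x (map (\<lambda>a. (a, True)) as)) = int (count (mset as) gen_x)"
proof (induction as)
  case (Cons a as)
  then show ?case by (cases a) auto
qed simp

text \<open>This is the homomorphism to the integers modulo \<open>m\<close> sending
  \<open>x\<close> to 1 and \<open>y\<close> to 0: only the relation for the power of
  \<open>x\<close> changes the sum, and it does so by \<open>m\<close>.\<close>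

lemma word_cong_exponent_x:
  assumes "word_cong (G_star_relations m n s) u v"
  shows "[sum_list (map exponent_x u) = sum_list (map exponent_x v)] (mod int m)"
  using assms
proof (induction rule: word_cong.induct)
  case (cancel a e)
  then show ?case by (cases a) auto
next
  case (rel u v)
  then show ?case
    by (auto simp: G_star_relations_def gen_pow_def sum_list_replicate cong_def)
qed (auto intro: cong_sym cong_trans cong_add)

text \<open>The right action of the words on \<open>\<int>/n\<close>, where \<open>y\<close> adds one and \<open>x\<close> multiplies by \<open>s\<close>,
  with \<open>t\<close> in the role of the inverse of \<open>s\<close> modulo \<open>n\<close>.\<close>

fun letter_action :: "int \<Rightarrow> int \<Rightarrow> gen \<times> bool \<Rightarrow> int \<Rightarrow> int" where
  "letter_action s t (gen_x, e) b = (if e then s else t) * b"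
| "letter_action s t (gen_y, e) b = b + (if e then 1 else - 1)"

lemma cong_letter_action: "[b = c] (mod k) \<Longrightarrow> [letter_action s t p b = letter_action s t p c] (mod k)"
  by (cases "(s, t, p, b)" rule: letter_action.cases) (auto intro: cong_mult cong_add cong_diff)

lemma cong_fold_letter_action:
  "[b = c] (mod k) \<Longrightarrow> [fold (letter_action s t) u b = fold (letter_action s t) u c] (mod k)"
  by (induction u arbitrary: b c) (auto intro: cong_letter_action)

lemma funpow_letter_action_gen_x:
  "(letter_action s t (gen_x, e) ^^ k) b = (if e then s else t) ^ k * b"
  by (induction k) auto

lemma funpow_letter_action_gen_y:
  "(letter_action s t (gen_y, e) ^^ k) b = b + (if e then int k else - int k)"
  by (induction k) auto

text \<open>Both sides of each relation act alike modulo \<open>n\<close>; for the conjugation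
  relation, \<open>s * (t * b + 1)\<close> is congruent to \<open>b + s\<close>. Allowing two
  congruent starting values \<open>b\<close> and \<open>c\<close> lets the case of concatenation
  compose.\<close>

lemma word_cong_letter_action:
  assumes "word_cong (G_star_relations m n s) u v"
    and st: "[s * t = 1] (mod int n)" and s: "[s ^ m = 1] (mod int n)"
  shows "[b = c] (mod int n) \<Longrightarrow> [fold (letter_action s t) u b = fold (letter_action s t) v c] (mod int n)"
  using assms(1)
proof (induction arbitrary: b c rule: word_cong.induct)
  case (refl u)
  then show ?case by (rule cong_fold_letter_action)
next
  case (sym u v)
  then show ?case by (meson cong_sym)
next
  case (trans u v w)
  then show ?case by (meson cong_refl cong_trans)
next
  case (append u u' v v')
  then show ?case by simp
next
  case (cancel a e)
  have "[s * t * b = 1 * c] (mod int n)" by (intro cong_mult st cancel)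
  then show ?case using cancel by (cases a) (auto simp: algebra_simps)
next
  case (rel u v)
  have "[s ^ m * b = 1 * c] (mod int n)" by (intro cong_mult s rel)
  moreover have "[b + int n = c + 0] (mod int n)" by (intro cong_add rel) (simp add: cong_def)
  moreover have "[s * t * b + s = 1 * c + s] (mod int n)" by (intro cong_add cong_mult st rel cong_refl)
  then have "[s * (t * b + 1) = c + s] (mod int n)" by (simp add: algebra_simps)
  ultimately show ?case
    using rel(1) by (auto simp: G_star_relations_def gen_pow_def funpow_letter_action_gen_x
        funpow_letter_action_gen_y algebra_simps)
qed

text \<open>In a product-one subsequence the exponent sum forces the number of terms
  \<open>x\<close> to be 0 modulo \<open>m\<close>, hence 0. Only terms \<open>y\<close> remain, and
  the action on 0 forces their number to be 0 modulo \<open>n\<close>, hence 0.\<close>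

lemma exists_product_one_free_G_star:
  fixes m n :: nat and s :: int
  assumes mn: "m > 0" "n > 0" and s: "coprime s (int n)" "ord (int n) s = m"
  shows "\<exists>S. set_mset S \<subseteq> carrier (G_star m n s) \<and> size S = m + n - 2 \<and> product_one_free (G_star m n s) S"
proof -
  define R where "R = G_star_relations m n s"
  let ?G = "presented_group R"
  let ?w = "\<lambda>a. word_class R [(a, True)]"
  \<comment> \<open>A multiset of generators, not of their classes: the letters can be counted
    separately without knowing that the classes differ.\<close>
  define M where "M = replicate_mset (m - 1) gen_x + replicate_mset (n - 1) gen_y"
  obtain t where t: "[s * t = 1] (mod int n)" using s(1) cong_solve_coprime_int by blast
  have sm: "[s ^ m = 1] (mod int n)" using ord_int_divides[OF mn(2), of s m] s(2) by simp
  have "product_one_free ?G (image_mset ?w M)"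
    unfolding product_one_free_def
  proof
    assume "\<exists>T. T \<subseteq># image_mset ?w M \<and> T \<noteq> {#} \<and> product_one ?G T"
    then obtain T where T: "T \<subseteq># image_mset ?w M" "T \<noteq> {#}" "product_one ?G T" by blast
    obtain N where N: "N \<subseteq># M" "T = image_mset ?w N"
      using T(1) image_mset_eq_plusD[of ?w M T] by (metis mset_subset_eq_add_left mset_subset_eq_exists_conv)
    obtain gs where gs: "mset gs = image_mset ?w N" "foldr (\<otimes>\<^bsub>?G\<^esub>) gs \<one>\<^bsub>?G\<^esub> = \<one>\<^bsub>?G\<^esub>"
      using T N by (auto simp: product_one_def)
    \<comment> \<open>The ordering with product \<open>\<one>\<close> is lifted to an ordering of
      the generators, so that it can be read as a word.\<close>
    have "\<exists>as. mset as = N \<and> gs = map ?w as"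
      using gs(1)
    proof (induction gs arbitrary: N)
      case (Cons g gs)
      then obtain a N' where N': "N = add_mset a N'" "g = ?w a" "mset gs = image_mset ?w N'"
        using msed_map_invR[of ?w N g "mset gs"] by auto
      then obtain as where "mset as = N'" "gs = map ?w as" using Cons.IH by blast
      then show ?case using N' by (intro exI[of _ "a # as"]) simp
    qed simp
    then obtain as where as: "mset as = N" "gs = map ?w as" by blast
    define u where "u = map (\<lambda>a. (a, True)) as"
    have "word_class R u = foldr (\<otimes>\<^bsub>?G\<^esub>) (map (word_class R) (map (\<lambda>a. [(a, True)]) as)) \<one>\<^bsub>?G\<^esub>"
      by (simp only: foldr_mult_word_class) (simp add: u_def)
    also have "\<dots> = word_class R []" using gs(2) by (simp add: as(2) comp_def word_class_Nil)
    finally have cong: "word_cong R u []" by (simp add: word_class_eq_iff)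
    have "count N a \<le> count M a" for a using N(1) by (simp add: subseteq_mset_def)
    from this[of gen_x] this[of gen_y]
    have le: "count N gen_x \<le> m - 1" "count N gen_y \<le> n - 1" by (simp_all add: M_def)
    have "sum_list (map exponent_x u) = int (count (mset as) gen_x)"
      unfolding u_def by (rule sum_list_exponent_x)
    then have "[int (count N gen_x) = 0] (mod int m)"
      using word_cong_exponent_x[OF cong[unfolded R_def]] as by simp
    then have "m dvd count N gen_x" by (simp add: cong_0_iff int_dvd_int_iff)
    then have cx: "count N gen_x = 0" using le mn by (auto dest: dvd_imp_le)
    then have "\<forall>a\<in>set as. a = gen_y" using as by (metis count_eq_zero_iff gen.exhaust set_mset_mset)
    then have as_eq: "as = replicate (length as) gen_y" by (simp add: replicate_eqI)
    then have "u = replicate (length as) (gen_y, True)" unfolding u_def by (metis map_replicate)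
    then have "[int (length as) = 0] (mod int n)"
      using word_cong_letter_action[OF cong[unfolded R_def] t sm, of 0 0]
      by (simp add: funpow_letter_action_gen_y)
    then have "n dvd length as" by (simp add: cong_0_iff int_dvd_int_iff)
    moreover have "count N gen_y = length as"
      using as(1) as_eq by (metis count_replicate_mset mset_replicate)
    ultimately have "length as = 0" using le mn by (auto dest: dvd_imp_le)
    then show False using as N T(2) by simp
  qed
  moreover have "set_mset (image_mset ?w M) \<subseteq> carrier ?G" by auto
  moreover have "size (image_mset ?w M) = m + n - 2" using mn by (simp add: M_def)
  ultimately show ?thesis unfolding G_star_eq R_def by blast
qed

theorem theorem1p1:
  fixes m n :: nat and s :: int
  assumes "m > 0" and "n > 0"
    and "coprime s (int n)"
    and "ord (int n) s = m"
    and "\<And>q. Factorial_Ring.prime q \<Longrightarrow> q dvd n \<Longrightarrow> ord (int q) s = m"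
  shows "small_davenport (G_star m n s) = m + n - 2"
  unfolding small_davenport_def
proof (rule Max_eqI)
  let ?L = "{l. \<exists>S. set_mset S \<subseteq> carrier (G_star m n s) \<and> size S = l \<and>
    product_one_free (G_star m n s) S}"
  show le: "l \<le> m + n - 2" if l: "l \<in> ?L" for l
  proof -
    obtain S where S: "set_mset S \<subseteq> carrier (G_star m n s)" "product_one_free (G_star m n s) S" "size S = l"
      using l by blast
    have "size S + 2 \<le> n + m"
      by (rule size_product_one_free_G_star_le[OF assms(1,2,5) S(1,2)])
    then show ?thesis using S(3) by simp
  qed
  \<comment> \<open>The upper bound also supplies the finiteness that \<open>Max\<close>
    requires.\<close>
  show "finite ?L" using le finite_nat_set_iff_bounded_le by blast
  show "m + n - 2 \<in> ?L"
    using exists_product_one_free_G_star[OF assms(1-4)] by blast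
qed

end
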